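(* Let $\star\in\{r,f\}$ and take $\mathtt{Ans}=\mathbb{R}_+\cup\{+\infty\}$ and $X=\Sigma_\star$. For every instruction $P$, the map $\kappa\mapsto\operatorname{wp}\llbracket P\rrbracket_\star(\kappa)$ is an upper $\omega$-continuous parametric prevision (on $\mathcal{M}_+(\Sigma_\star)$).
   Context: $\mathcal{V}$ is a countable set of variables. Expressions: $e ::= a \mid x \mid \dot{-}e \mid e\,\dot{+}\,e \mid e\,\dot{-}\,e\mid e\,\dot{\times}\, e\mid e\,\dot{/}\,e$ with $a\in\mathbb{Q}$, $x\in\mathcal{V}$. Tests: $t::= e\,\dot{<=}\,e\mid e\,\dot{<}\,e\mid e\,\dot{==}\,e\mid e\,\dot{!=}\,e\mid\, !t$. Instructions: $P::=\mathrm{skip}\mid x:=e\mid \mathrm{if}\ t\ \mathrm{then}\ P_1\ \mathrm{else}\ P_0\mid\mathrm{while}\ t\ P\mid P;Q$. Values. $\mathbb{F}\subset\mathbb{R}$ is the finite set of floating-point numbers, with smallest element $F_{\min}$ and largest element $F_{\max}$. $\mathbb{R}_e=\mathbb{R}\cup\{\mathbf{err}\}$, $\mathbb{F}_e=\mathbb{F}\cup\{\mathbf{err}\}$, with $\mathbf{err}$ an extra symbol. For $r\in\mathbb{R}_e$ and $\diamond\in\{+,-,\times,/\}$: $\mathbf{err}\diamond r=r\diamond\mathbf{err}=r/0=-\mathbf{err}=\mathbf{err}$. $\mathbf{inj}:\mathbb{F}_e\to\mathbb{R}_e$ is the inclusion. $\mathbf{proj}:\mathbb{R}_e\to\mathbb{F}_e$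 is a fixed Borel measurable map with $\mathbf{proj}(r)=\mathbf{err}$ if $r\notin[F_{\min},F_{\max}]$, and $\mathbf{proj}(\mathbf{inj}(f))=f$ for all $f\in\mathbb{F}_e$. Environments. $\Sigma_r$ is the set of maps $\mathcal{V}\to\mathbb{R}_e$, $\Sigma_f$ the set of maps $\mathcal{V}\to\mathbb{F}_e$. $\mathbb{R}_e$ has the topology whose opens are the open subsets of $\mathbb{R}$, $\{\mathbf{err}\}$, and their unions; $\mathbb{F}_e$ is discrete; $\Sigma_r$, $\Sigma_f$ have the product topology; all carry Borel $\sigma$-algebras. Expression semantics. Real: $\llbracket a\rrbracket_r(\rho)=a$, $\llbracket x\rrbracket_r(\rho)=\rho(x)$, $\llbracket \dot{-}e\rrbracket_r(\rho)=-\llbracket e\rrbracket_r(\rho)$, $\llbracket e_1\dot{\diamond}e_2\rrbracket_r(\rho)=\llbracket e_1\rrbracket_r(\rho)\diamond\llbracket e_2\rrbracket_r(\rho)$. Floating-point: $\llbracket a\rrbracket_f(\rho)=\mathbf{proj}(a)$, $\llbracket x\rrbracket_f(\rho)=\rho(x)$, $\llbracket \dot{-}e\rrbracket_f(\rho)=\mathbf{proj}(-\mathbf{inj}(\llbracket e\rrbracket_f(\rho)))$, $\llbracket e_1\dot{\diamond}e_2\rrbracket_f(\rho)=\mathbf{proj}(\mathbf{inj}(\llbracket e_1\rrbracket_f(\rho))\diamond\mathbf{inj}(\llbracket e_2\rrbracket_f(\rho)))$. Test semantics. For $R$ one of $\le,<,=,\ne$ (corresponding to $\dot{<=},\dot{<},\dot{==},\dot{!=}$),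 $\llbracket e_1\dot{R}e_2\rrbracket_\star(\rho)$ is $\{0,1\}$ if $\llbracket e_1\rrbracket_\star(\rho)=\mathbf{err}$ or $\llbracket e_2\rrbracket_\star(\rho)=\mathbf{err}$; otherwise it is $\{1\}$ if $\llbracket e_1\rrbracket_\star(\rho)\,R\,\llbracket e_2\rrbracket_\star(\rho)$ and $\{0\}$ if not. $\llbracket !t\rrbracket_\star(\rho)=\{1-v\mid v\in\llbracket t\rrbracket_\star(\rho)\}$. Instruction semantics. For $\kappa:\Sigma_\star\to\mathtt{Ans}$, $\operatorname{wp}\llbracket P\rrbracket_\star(\kappa):\Sigma_\star\to\mathtt{Ans}$ is defined by recursion on $P$: - $\operatorname{wp}\llbracket\mathrm{skip}\rrbracket_\star(\kappa)=\kappa$; - $\operatorname{wp}\llbracket x:=e\rrbracket_\star(\kappa)(\rho)=\kappa(\rho[x\to\llbracket e\rrbracket_\star(\rho)])$; - $\operatorname{wp}\llbracket P;Q\rrbracket_\star(\kappa)=\operatorname{wp}\llbracket P\rrbracket_\star(\operatorname{wp}\llbracket Q\rrbracket_\star(\kappa))$; - $\operatorname{wp}\llbracket\mathrm{if}\ t\ \mathrm{then}\ P_1\ \mathrm{else}\ P_0\rrbracket_\star(\kappa)(\rho)=\sup_{i\in\llbracket t\rrbracket_\star(\rho)}\operatorname{wp}\llbracket P_i\rrbracket_\star(\kappa)(\rho)$; - $\operatorname{wp}\llbracket\mathrm{while}\ t\ P\rrbracket_\star=\sup_{n\in\mathbb{N}}H_{t,P}^n(\bot)$, where, for $\varphi:(\Sigma_\star\to\mathtt{Ans})\to(\Sigma_\star\to\mathtt{Ans})$,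 $H_{t,P}(\varphi)(\kappa)(\rho)$ equals $\operatorname{wp}\llbracket P\rrbracket_\star(\varphi(\kappa))(\rho)$ if $\llbracket t\rrbracket_\star(\rho)=\{1\}$, equals $\kappa(\rho)$ if $\llbracket t\rrbracket_\star(\rho)=\{0\}$, and equals the supremum of these two values if $\llbracket t\rrbracket_\star(\rho)=\{0,1\}$; $\bot(\kappa)(\rho)$ is the least element of $\mathtt{Ans}$ for all $\kappa,\rho$; suprema are pointwise. Parametric previsions. For a topological space $X$ with its Borel $\sigma$-algebra, $\mathcal{M}_+(X)$ is the set of measurable functions $X\to[0,+\infty]$, ordered pointwise. Arithmetic conventions: $0\times(+\infty)=(+\infty)\times 0=0$, $(+\infty)\times(+\infty)=+\infty$, $x+(+\infty)=(+\infty)+x=+\infty$. A map $F:\mathcal{M}_+(X)\to\mathcal{M}_+(X)$ is a parametric prevision if it is positively homogeneous ($F(\alpha f)=\alpha F(f)$ for real $\alpha\ge0$) and monotonic. It is upper if $F(f+g)\le F(f)+F(g)$ for all $f,g\in\mathcal{M}_+(X)$, and $\omega$-continuous if $F(\sup_n f_n)=\sup_nF(f_n)$ for every ascending sequence $(f_n)_{n\in\mathbb{N}}$ in $\mathcal{M}_+(X)$. The claim includes that $\operatorname{wp}\llbracket P\rrbracket_\star$ maps $\mathcal{M}_+(\Sigma_\star)$ to itself. *)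

theory Defs
  imports "HOL-Analysis.Analysis"
begin

datatype aop = Add | Sub | Mul | Div

datatype cmp = Le | Lt | Eq | Ne

datatype 'v expr =
    Const rat
  | Var 'v
  | Minus "'v expr"
  | Bin aop "'v expr" "'v expr"

datatype 'v test =
    Cmp cmp "'v expr" "'v expr"
  | Neg "'v test"

datatype 'v instr =
    Skip
  | Assign 'v "'v expr"
  | Cond "'v test" "'v instr" "'v instr"  \<comment> \<open>\<open>Cond t P1 P0\<close>: the then-branch comes first\<close>
  | While "'v test" "'v instr"
  | Seq "'v instr" "'v instr"


datatype real_err = Err | Num real

text \<open>
  \<open>floats_err F\<close> is \<open>F\<close> with the error symbol added. It is represented as a subset of
  \<^typ>\<open>real_err\<close>, so the inclusion of floating-point values into \<^typ>\<open>real_err\<close> is the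
  identity and is not written below.
\<close>

definition floats_err :: "real set \<Rightarrow> real_err set" where
  "floats_err F = insert Err (Num ` F)"

fun neg_err :: "real_err \<Rightarrow> real_err" where
  "neg_err Err = Err"
| "neg_err (Num a) = Num (- a)"

fun aop_err :: "aop \<Rightarrow> real_err \<Rightarrow> real_err \<Rightarrow> real_err" where
  "aop_err d Err s = Err"
| "aop_err d (Num a) Err = Err"
| "aop_err Add (Num a) (Num b) = Num (a + b)"
| "aop_err Sub (Num a) (Num b) = Num (a - b)"
| "aop_err Mul (Num a) (Num b) = Num (a * b)"
| "aop_err Div (Num a) (Num b) = (if b = 0 then Err else Num (a / b))"

fun cmp_real :: "cmp \<Rightarrow> real \<Rightarrow> real \<Rightarrow> bool" where
  "cmp_real Le a b \<longleftrightarrow> a \<le> b"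
| "cmp_real Lt a b \<longleftrightarrow> a < b"
| "cmp_real Eq a b \<longleftrightarrow> a = b"
| "cmp_real Ne a b \<longleftrightarrow> a \<noteq> b"


definition real_err_topology :: "real_err topology" where
  "real_err_topology = topology_generated_by (insert {Err} {Num ` U | U. open U})"

lemma openin_real_err_topology:
  "openin real_err_topology W \<longleftrightarrow> (\<exists>U. open U \<and> (W = Num ` U \<or> W = insert Err (Num ` U)))"
proof
  let ?B = "insert {Err} {Num ` U | U. open U}"
  assume "openin real_err_topology W"
  then have "generate_topology_on ?B W"
    by (simp add: real_err_topology_def openin_topology_generated_by_iff)
  then have "open (Num -` W)"
  proof induction
    case (Int a b)
    then show ?case by (simp add: open_Int)
  next
    case (UN K)
    then show ?case by (auto simp: vimage_Union)
  next
    case (Basis S)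
    have "Num -` Num ` U = U" "Num -` {Err} = {}" for U by auto
    with Basis show ?case by auto
  qed auto
  moreover have "W = Num ` (Num -` W) \<or> W = insert Err (Num ` (Num -` W))"
    by (auto simp: image_iff) (metis real_err.exhaust)+
  ultimately show "\<exists>U. open U \<and> (W = Num ` U \<or> W = insert Err (Num ` U))"
    by blast
next
  have *: "openin real_err_topology {Err}" "open U \<Longrightarrow> openin real_err_topology (Num ` U)" for U
    by (auto simp: real_err_topology_def intro: topology_generated_by_Basis)
  assume "\<exists>U. open U \<and> (W = Num ` U \<or> W = insert Err (Num ` U))"
  then show "openin real_err_topology W"
    using * openin_Un[OF *(1)] by auto
qed

text \<open>
  The two semantics and their spaces of environments. Floating-point environments are the
  points of \<open>env_topology Float_Sem F\<close>, i.e. the maps with all values in \<open>floats_err F\<close>.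
\<close>

datatype semantics = Real_Sem | Float_Sem

type_synonym 'v env = "'v \<Rightarrow> real_err"

fun env_topology :: "semantics \<Rightarrow> real set \<Rightarrow> 'v env topology" where
  "env_topology Real_Sem F = product_topology (\<lambda>_. real_err_topology) UNIV"
| "env_topology Float_Sem F = product_topology (\<lambda>_. discrete_topology (floats_err F)) UNIV"

definition borel_of :: "'a topology \<Rightarrow> 'a measure" where
  "borel_of X = sigma (topspace X) {U. openin X U}"

definition is_proj :: "real set \<Rightarrow> (real_err \<Rightarrow> real_err) \<Rightarrow> bool" where
  "is_proj F proj \<longleftrightarrow>
     proj \<in> borel_of real_err_topology \<rightarrow>\<^sub>M borel_of (discrete_topology (floats_err F)) \<and>
     (\<forall>r. r \<notin> Num ` {Min F..Max F} \<longrightarrow> proj r = Err) \<and>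
     (\<forall>f\<in>floats_err F. proj f = f)"


primrec eval_real :: "'v expr \<Rightarrow> 'v env \<Rightarrow> real_err" where
  "eval_real (Const a) \<rho> = Num (of_rat a)"
| "eval_real (Var x) \<rho> = \<rho> x"
| "eval_real (Minus e) \<rho> = neg_err (eval_real e \<rho>)"
| "eval_real (Bin d e1 e2) \<rho> = aop_err d (eval_real e1 \<rho>) (eval_real e2 \<rho>)"

primrec eval_float :: "(real_err \<Rightarrow> real_err) \<Rightarrow> 'v expr \<Rightarrow> 'v env \<Rightarrow> real_err" where
  "eval_float proj (Const a) \<rho> = proj (Num (of_rat a))"
| "eval_float proj (Var x) \<rho> = \<rho> x"
| "eval_float proj (Minus e) \<rho> = proj (neg_err (eval_float proj e \<rho>))"
| "eval_float proj (Bin d e1 e2) \<rho> =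
     proj (aop_err d (eval_float proj e1 \<rho>) (eval_float proj e2 \<rho>))"

fun eval :: "semantics \<Rightarrow> (real_err \<Rightarrow> real_err) \<Rightarrow> 'v expr \<Rightarrow> 'v env \<Rightarrow> real_err" where
  "eval Real_Sem proj = eval_real"
| "eval Float_Sem proj = eval_float proj"

text \<open>
  Tests and instructions are interpreted with respect to an interpretation \<open>ev\<close> of expressions,
  which will be \<open>eval Real_Sem proj\<close> or \<open>eval Float_Sem proj\<close>.
\<close>

primrec test_sem :: "('v expr \<Rightarrow> 'v env \<Rightarrow> real_err) \<Rightarrow> 'v test \<Rightarrow> 'v env \<Rightarrow> nat set" where
  "test_sem ev (Cmp R e1 e2) \<rho> =
     (case (ev e1 \<rho>, ev e2 \<rho>) of
        (Num a, Num b) \<Rightarrow> if cmp_real R a b then {1} else {0}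
      | _ \<Rightarrow> {0, 1})"
| "test_sem ev (Neg t) \<rho> = {1 - v | v. v \<in> test_sem ev t \<rho>}"

text \<open>
  In \<open>while_step T W\<close>, \<open>T\<close> stands for the meaning of the test and \<open>W\<close> for the transformer of
  the loop body. The remaining case of the conditional is \<open>T \<rho> = {0, 1}\<close>.
\<close>

definition while_step ::
    "('s \<Rightarrow> nat set) \<Rightarrow> (('s \<Rightarrow> 'ans) \<Rightarrow> 's \<Rightarrow> 'ans) \<Rightarrow>
     (('s \<Rightarrow> 'ans) \<Rightarrow> 's \<Rightarrow> 'ans) \<Rightarrow> ('s \<Rightarrow> 'ans) \<Rightarrow> 's \<Rightarrow> 'ans::complete_lattice" where
  "while_step T W \<phi> \<kappa> \<rho> =
     (if T \<rho> = {1} then W (\<phi> \<kappa>) \<rho>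
      else if T \<rho> = {0} then \<kappa> \<rho>
      else sup (W (\<phi> \<kappa>) \<rho>) (\<kappa> \<rho>))"

text \<open>
  In the loop case \<open>bot\<close> and the supremum are those of the function space, hence pointwise in
  both the continuation and the environment.
\<close>

primrec wp ::
    "('v expr \<Rightarrow> 'v env \<Rightarrow> real_err) \<Rightarrow> 'v instr \<Rightarrow>
     ('v env \<Rightarrow> 'ans::complete_lattice) \<Rightarrow> 'v env \<Rightarrow> 'ans" where
  "wp ev Skip = (\<lambda>\<kappa>. \<kappa>)"
| "wp ev (Assign x e) = (\<lambda>\<kappa> \<rho>. \<kappa> (\<rho>(x := ev e \<rho>)))"
| "wp ev (Cond t P1 P0) =
     (\<lambda>\<kappa> \<rho>. SUP i\<in>test_sem ev t \<rho>. if i = 1 then wp ev P1 \<kappa> \<rho> else wp ev P0 \<kappa> \<rho>)"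
| "wp ev (While t P) = (SUP n. (while_step (test_sem ev t) (wp ev P) ^^ n) bot)"
| "wp ev (Seq P Q) = (\<lambda>\<kappa>. wp ev P (wp ev Q \<kappa>))"


text \<open>
  A measurable function on the space \<open>X\<close> is given by a function on the whole type; only its
  values on \<open>topspace X\<close> matter, so all (in)equalities between such functions, including the
  order, are required on \<open>topspace X\<close> only. In particular the monotonicity clause below entails
  that \<open>G f\<close> depends, on \<open>topspace X\<close>, only on the values of \<open>f\<close> there.
\<close>

definition Mplus :: "'a topology \<Rightarrow> ('a \<Rightarrow> ennreal) set" where
  "Mplus X = borel_of X \<rightarrow>\<^sub>M borel"

definition parametric_prevision :: "'a topology \<Rightarrow> (('a \<Rightarrow> ennreal) \<Rightarrow> 'a \<Rightarrow> ennreal) \<Rightarrow> bool" where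
  "parametric_prevision X G \<longleftrightarrow>
     (\<forall>f\<in>Mplus X. G f \<in> Mplus X) \<and>
     (\<forall>f\<in>Mplus X. \<forall>a::real. 0 \<le> a \<longrightarrow>
        (\<forall>x\<in>topspace X. G (\<lambda>y. ennreal a * f y) x = ennreal a * G f x)) \<and>
     (\<forall>f\<in>Mplus X. \<forall>g\<in>Mplus X. (\<forall>x\<in>topspace X. f x \<le> g x) \<longrightarrow>
        (\<forall>x\<in>topspace X. G f x \<le> G g x))"

definition upper_prevision :: "'a topology \<Rightarrow> (('a \<Rightarrow> ennreal) \<Rightarrow> 'a \<Rightarrow> ennreal) \<Rightarrow> bool" where
  "upper_prevision X G \<longleftrightarrow>
     (\<forall>f\<in>Mplus X. \<forall>g\<in>Mplus X. \<forall>x\<in>topspace X. G (\<lambda>y. f y + g y) x \<le> G f x + G g x)"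

definition omega_continuous :: "'a topology \<Rightarrow> (('a \<Rightarrow> ennreal) \<Rightarrow> 'a \<Rightarrow> ennreal) \<Rightarrow> bool" where
  "omega_continuous X G \<longleftrightarrow>
     (\<forall>f :: nat \<Rightarrow> 'a \<Rightarrow> ennreal.
        (\<forall>n. f n \<in> Mplus X) \<longrightarrow> (\<forall>n. \<forall>x\<in>topspace X. f n x \<le> f (Suc n) x) \<longrightarrow>
        (\<forall>x\<in>topspace X. G (\<lambda>y. SUP n. f n y) x = (SUP n. G (f n) x)))"

end

theory Submission imports Defs begin

text \<open>
  The identity, reindexing along a measurable map, composition, measurable case distinction and
  pointwise suprema all preserve upper \<open>\<omega>\<close>-continuous parametric previsions, and the weakest
  precondition transformers are built from these operations. Countability of the set of variables
  enters through the measurability of assignment: the space of environments is then second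
  countable, so a map into it is measurable as soon as its components are.
\<close>

section \<open>Borel spaces of abstract topologies\<close>

lemma space_borel_of [simp]: "space (borel_of X) = topspace X"
  by (simp add: borel_of_def space_measure_of_conv)

lemma openin_sets_borel_of: "openin X U \<Longrightarrow> U \<in> sets (borel_of X)"
  unfolding borel_of_def by (rule in_measure_of) (auto dest: openin_subset)

lemma measurable_borel_ofI:
  assumes "f \<in> space M \<rightarrow> topspace X"
    and "\<And>U. openin X U \<Longrightarrow> f -` U \<inter> space M \<in> sets M"
  shows "f \<in> M \<rightarrow>\<^sub>M borel_of X"
  unfolding borel_of_def
  by (rule measurable_measure_of) (use assms in \<open>auto dest: openin_subset\<close>)

lemma continuous_map_measurable_borel_of:
  assumes "continuous_map X Y f"
  shows "f \<in> borel_of X \<rightarrow>\<^sub>M borel_of Y"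
proof (rule measurable_borel_ofI)
  show "f \<in> space (borel_of X) \<rightarrow> topspace Y"
    using assms by (auto simp: continuous_map_def)
next
  fix U assume "openin Y U"
  then have "openin X {x \<in> topspace X. f x \<in> U}"
    using assms by (auto simp: continuous_map_def)
  moreover have "f -` U \<inter> space (borel_of X) = {x \<in> topspace X. f x \<in> U}"
    by auto
  ultimately show "f -` U \<inter> space (borel_of X) \<in> sets (borel_of X)"
    by (simp add: openin_sets_borel_of)
qed

lemma measurable_product_projection:
  "(\<lambda>x. x i) \<in> borel_of (product_topology X UNIV) \<rightarrow>\<^sub>M borel_of (X i)"
  by (intro continuous_map_measurable_borel_of continuous_map_product_projection) simp

text \<open>Within the product space, each open set is a countable union of cylinders with finitely
  many constraints drawn from countable bases, because there are countably many indices. Preimages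
  of such cylinders are measurable one coordinate at a time.\<close>

lemma measurable_borel_of_product:
  fixes X :: "'i::countable \<Rightarrow> 'a topology"
  assumes sc: "\<And>i. second_countable (X i)"
    and f: "\<And>i. (\<lambda>x. f x i) \<in> M \<rightarrow>\<^sub>M borel_of (X i)"
  shows "f \<in> M \<rightarrow>\<^sub>M borel_of (product_topology X UNIV)"
proof (rule measurable_borel_ofI)
  have f_top: "f x i \<in> topspace (X i)" if "x \<in> space M" for x i
    using measurable_space[OF f that] by simp
  then show "f \<in> space M \<rightarrow> topspace (product_topology X UNIV)"
    by (auto simp: PiE_UNIV_domain)
  have "\<forall>i. \<exists>B. countable B \<and> (\<forall>V\<in>B. openin (X i) V) \<and>
      (\<forall>U x. openin (X i) U \<and> x \<in> U \<longrightarrow> (\<exists>V\<in>B. x \<in> V \<and> V \<subseteq> U))"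
    using sc unfolding second_countable_def by blast
  then obtain B where B: "\<And>i. countable (B i)" "\<And>i V. V \<in> B i \<Longrightarrow> openin (X i) V"
      "\<And>i U x. openin (X i) U \<Longrightarrow> x \<in> U \<Longrightarrow> \<exists>V\<in>B i. x \<in> V \<and> V \<subseteq> U"
    by metis
  define cyl where "cyl A = {g. \<forall>(i, V)\<in>A. g i \<in> V}" for A :: "('i \<times> 'a set) set"
  fix S assume S: "openin (product_topology X UNIV) S"
  \<comment> \<open>Inclusion in \<open>S\<close> is asked only on the product space: at its
    unconstrained coordinates a cylinder also admits values outside the component spaces.\<close>
  define \<A> where "\<A> = {A. finite A \<and> A \<subseteq> Sigma UNIV B \<and> cyl A \<inter> topspace (product_topology X UNIV) \<subseteq> S}"
  have "countable {A. A \<subseteq> Sigma UNIV B \<and> finite A}"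
    using countable_Collect_finite_subset[OF countable_SIGMA[of UNIV B]] B(1)
    by (simp add: conj_commute)
  then have cA: "countable \<A>"
    by (rule countable_subset[rotated]) (auto simp: \<A>_def)
  have "g \<in> (\<Union>A\<in>\<A>. cyl A)" if g: "g \<in> S" for g
  proof -
    obtain U where U: "finite {i. U i \<noteq> topspace (X i)}" "\<And>i. openin (X i) (U i)"
        "g \<in> Pi\<^sub>E UNIV U" "Pi\<^sub>E UNIV U \<subseteq> S"
      using S[unfolded openin_product_topology_alt, THEN bspec, OF g] by auto
    have "\<exists>V\<in>B i. g i \<in> V \<and> V \<subseteq> U i" for i
      using B(3)[OF U(2)[of i], of "g i"] U(3) by (auto simp: PiE_UNIV_domain)
    then obtain V where V: "\<And>i. V i \<in> B i" "\<And>i. g i \<in> V i" "\<And>i. V i \<subseteq> U i"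
      by metis
    \<comment> \<open>Only the finitely many coordinates at which \<open>U\<close> is not the whole
      space are constrained, so \<open>A\<close> is finite although \<open>V\<close> is chosen at
      every index.\<close>
    define A where "A = (\<lambda>i. (i, V i)) ` {i. U i \<noteq> topspace (X i)}"
    have "h i \<in> U i" if "h \<in> cyl A" "\<And>i. h i \<in> topspace (X i)" for h i
      using that V(3)[of i] by (cases "U i = topspace (X i)") (auto simp: cyl_def A_def)
    then have "cyl A \<inter> topspace (product_topology X UNIV) \<subseteq> Pi\<^sub>E UNIV U"
      by (auto simp: PiE_UNIV_domain Pi_iff)
    then have "A \<in> \<A>"
      using U V by (auto simp: \<A>_def A_def)
    moreover have "g \<in> cyl A"
      using V by (auto simp: cyl_def A_def)
    ultimately show ?thesis by blast
  qed
  then have eq: "f -` S \<inter> space M = (\<Union>A\<in>\<A>. {x \<in> space M. f x \<in> cyl A})"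
  proof (intro equalityI subsetI)
    fix x assume "x \<in> (\<Union>A\<in>\<A>. {x \<in> space M. f x \<in> cyl A})"
    then obtain A where A: "A \<in> \<A>" "x \<in> space M" "f x \<in> cyl A"
      by blast
    then have "f x \<in> cyl A \<inter> topspace (product_topology X UNIV)"
      using f_top by (simp add: PiE_UNIV_domain)
    then show "x \<in> f -` S \<inter> space M"
      using A by (auto simp: \<A>_def)
  qed blast
  have "{x \<in> space M. f x \<in> cyl A} \<in> sets M" if "A \<in> \<A>" for A
  proof -
    have "{x \<in> space M. case p of (i, V) \<Rightarrow> f x i \<in> V} \<in> sets M" if "p \<in> A" for p
    proof (cases p)
      case (Pair i V)
      then have "V \<in> sets (borel_of (X i))"
        using \<open>p \<in> A\<close> \<open>A \<in> \<A>\<close> B(2) by (intro openin_sets_borel_of) (auto simp: \<A>_def)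
      from measurable_sets[OF f this] show ?thesis
        by (simp add: Pair vimage_def Int_def conj_commute)
    qed
    moreover have "finite A" using that by (simp add: \<A>_def)
    ultimately show ?thesis
      unfolding cyl_def mem_Collect_eq by (intro sets.sets_Collect_finite_All)
  qed
  then show "f -` S \<inter> space M \<in> sets M"
    unfolding eq using cA by (intro sets.countable_UN'') auto
qed

text \<open>The point \<open>Err\<close> is isolated, so its singleton together with the images of a
  countable base of the reals forms a countable base.\<close>

lemma second_countable_real_err: "second_countable real_err_topology"
proof -
  obtain B :: "real set set" where B: "countable B" "topological_basis B"
    using ex_countable_basis by blast
  have "\<exists>V\<in>insert {Err} ((`) Num ` B). x \<in> V \<and> V \<subseteq> W"
    if W: "openin real_err_topology W" "x \<in> W" for W x
  proof (cases x)
    case Err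
    then show ?thesis using W by auto
  next
    case (Num a)
    obtain U where U: "open U" "W = Num ` U \<or> W = insert Err (Num ` U)"
      using W by (auto simp: openin_real_err_topology)
    then have "a \<in> U" using W Num by auto
    then obtain V where "V \<in> B" "a \<in> V" "V \<subseteq> U"
      using topological_basisE[OF B(2) U(1)] by metis
    then show ?thesis using U Num by (intro bexI[of _ "Num ` V"]) auto
  qed
  \<comment> \<open>For \<open>{Err}\<close> the real part \<open>U\<close> of the description of
    open sets is empty.\<close>
  moreover have "openin real_err_topology V" if "V \<in> insert {Err} ((`) Num ` B)" for V
    using that topological_basis_open[OF B(2)]
    by (auto simp: openin_real_err_topology intro: exI[of _ "{}"])
  ultimately show ?thesis
    unfolding second_countable_def using B(1)
    by (intro exI[of _ "insert {Err} ((`) Num ` B)"]) auto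
qed

section \<open>Measurability of the semantics of expressions and tests\<close>

text \<open>The value at \<open>Err\<close> is a convention; errors are recorded separately by the
  set where a function equals \<open>Err\<close>. This coding reduces measurability to real-valued
  functions.\<close>

fun real_part :: "real_err \<Rightarrow> real" where
  "real_part Err = 0"
| "real_part (Num a) = a"

lemma topspace_real_err [simp]: "topspace real_err_topology = UNIV"
proof -
  have "insert Err (range Num) = UNIV"
    by (auto simp: image_iff) (metis real_err.exhaust)
  moreover have "openin real_err_topology (insert Err (range Num))"
    unfolding openin_real_err_topology by blast
  ultimately show ?thesis
    by (metis openin_subset top.extremum_unique)
qed

text \<open>The topology is that of the disjoint union of the real line and one isolated point, so
  measurability splits into the error event and a real-valued function.\<close>

lemma measurable_real_err_iff:
  "f \<in> M \<rightarrow>\<^sub>M borel_of real_err_topology \<longleftrightarrow>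
     {x \<in> space M. f x = Err} \<in> sets M \<and> (\<lambda>x. real_part (f x)) \<in> borel_measurable M"
proof safe
  assume f: "f \<in> M \<rightarrow>\<^sub>M borel_of real_err_topology"
  have "openin real_err_topology {Err}"
    by (auto simp: openin_real_err_topology intro: exI[of _ "{}"])
  from measurable_sets[OF f openin_sets_borel_of[OF this]]
  show "{x \<in> space M. f x = Err} \<in> sets M"
    by (simp add: vimage_def Int_def conj_commute)
  have "real_part \<in> borel_measurable (borel_of real_err_topology)"
  proof (rule borel_measurableI)
    fix U :: "real set" assume "open U"
    \<comment> \<open>The default value puts \<open>Err\<close> into the preimage exactly when
      \<open>U\<close> contains 0. Both shapes are open, so \<open>real_part\<close> is even
      continuous.\<close>
    have "real_part -` U = (if 0 \<in> U then insert Err (Num ` U) else Num ` U)"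
    proof -
      have "y \<in> real_part -` U \<longleftrightarrow> y \<in> (if 0 \<in> U then insert Err (Num ` U) else Num ` U)" for y
        by (cases y) auto
      then show ?thesis by blast
    qed
    then have "openin real_err_topology (real_part -` U)"
      using \<open>open U\<close> by (auto simp: openin_real_err_topology)
    then show "real_part -` U \<inter> space (borel_of real_err_topology)
        \<in> sets (borel_of real_err_topology)"
      by (simp add: openin_sets_borel_of)
  qed
  from measurable_compose[OF f this]
  show "(\<lambda>x. real_part (f x)) \<in> borel_measurable M" .
next
  assume E [measurable]: "{x \<in> space M. f x = Err} \<in> sets M"
    and r [measurable]: "(\<lambda>x. real_part (f x)) \<in> borel_measurable M"
  show "f \<in> M \<rightarrow>\<^sub>M borel_of real_err_topology"
  proof (rule measurable_borel_ofI)
    fix W assume "openin real_err_topology W"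
    then obtain U where U: "open U" "W = Num ` U \<or> W = insert Err (Num ` U)"
      by (auto simp: openin_real_err_topology)
    have [measurable]: "U \<in> sets borel" using U(1) by simp
    have "f x \<in> W \<longleftrightarrow> (if f x = Err then Err \<in> W else real_part (f x) \<in> U)" for x
      using U(2) by (cases "f x") auto
    then have eq: "f -` W \<inter> space M = {x \<in> space M. if f x = Err then Err \<in> W else real_part (f x) \<in> U}"
      by auto
    show "f -` W \<inter> space M \<in> sets M"
      unfolding eq by measurable
  qed auto
qed

section \<open>Arithmetic on reals with an error value\<close>

lemma measurable_Num: "(\<lambda>_. Num a) \<in> M \<rightarrow>\<^sub>M borel_of real_err_topology"
  by (rule measurable_const) simp

lemma measurable_neg_err:
  assumes "f \<in> M \<rightarrow>\<^sub>M borel_of real_err_topology"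
  shows "(\<lambda>x. neg_err (f x)) \<in> M \<rightarrow>\<^sub>M borel_of real_err_topology"
proof -
  have "neg_err y = Err \<longleftrightarrow> y = Err" "real_part (neg_err y) = - real_part y" for y
    by (cases y; simp)+
  then show ?thesis using assms by (simp add: measurable_real_err_iff)
qed

lemma measurable_aop_err:
  assumes "f \<in> M \<rightarrow>\<^sub>M borel_of real_err_topology" "g \<in> M \<rightarrow>\<^sub>M borel_of real_err_topology"
  shows "(\<lambda>x. aop_err d (f x) (g x)) \<in> M \<rightarrow>\<^sub>M borel_of real_err_topology"
proof -
  \<comment> \<open>Real division is total; what \<open>ar\<close> yields at a zero divisor is
    discarded by the case distinction in \<open>2\<close>.\<close>
  define ar where "ar = (case d of Add \<Rightarrow> (+) | Sub \<Rightarrow> (-) | Mul \<Rightarrow> (*) | Div \<Rightarrow> ((/) :: real \<Rightarrow> _))"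
  have 1: "aop_err d y z = Err \<longleftrightarrow> y = Err \<or> z = Err \<or> d = Div \<and> real_part z = 0" for y z
    by (cases y; cases z; cases d) auto
  have 2: "real_part (aop_err d y z) =
      (if y = Err \<or> z = Err \<or> d = Div \<and> real_part z = 0 then 0 else ar (real_part y) (real_part z))" for y z
    by (cases y; cases z; cases d) (auto simp: ar_def)
  have [measurable]: "{x \<in> space M. f x = Err} \<in> sets M" "(\<lambda>x. real_part (f x)) \<in> borel_measurable M"
    "{x \<in> space M. g x = Err} \<in> sets M" "(\<lambda>x. real_part (g x)) \<in> borel_measurable M"
    using assms by (auto simp: measurable_real_err_iff)
  have [measurable]: "(\<lambda>x. ar (real_part (f x)) (real_part (g x))) \<in> borel_measurable M"
    unfolding ar_def by (cases d) auto
  show ?thesis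
    unfolding measurable_real_err_iff 1 2 by measurable
qed

section \<open>Comparisons and tests\<close>

lemma measurable_cmp_real:
  assumes [measurable]: "f \<in> borel_measurable M" "g \<in> borel_measurable M"
  shows "{x \<in> space M. cmp_real R (f x) (g x)} \<in> sets M"
  by (cases R) simp_all

lemma test_sem_Neg: "test_sem ev (Neg t) \<rho> = (-) 1 ` test_sem ev t \<rho>"
  by auto

text \<open>Negation exchanges the two definite outcomes and keeps the undecided one; truncated
  subtraction from 1 is complementation on 0 and 1. This trichotomy later turns the supremum over
  outcomes of a conditional into a three-way case distinction.\<close>

lemma test_sem_cases: "test_sem ev t \<rho> \<in> {{0}, {1}, {0, 1}}"
proof (induction t)
  case (Cmp R e1 e2)
  then show ?case by (simp split: real_err.split)
next
  case (Neg t)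
  then show ?case
    by (simp only: test_sem_Neg insert_iff empty_iff) (elim disjE; simp add: insert_commute)
qed

text \<open>Both definite outcomes go through one induction, since negation exchanges them and each
  case needs the hypothesis for the other.\<close>

lemma measurable_test_sem:
  assumes ev: "\<And>e. ev e \<in> M \<rightarrow>\<^sub>M borel_of real_err_topology"
  shows "{\<rho> \<in> space M. test_sem ev t \<rho> = {v}} \<in> sets M"
proof -
  have "{\<rho> \<in> space M. test_sem ev t \<rho> = {0}} \<in> sets M \<and>
        {\<rho> \<in> space M. test_sem ev t \<rho> = {1}} \<in> sets M"
  proof (induction t)
    case (Cmp R e1 e2)
    have [measurable]: "{x \<in> space M. ev e x = Err} \<in> sets M"
      "(\<lambda>x. real_part (ev e x)) \<in> borel_measurable M" for e
      using ev[of e] by (auto simp: measurable_real_err_iff)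
    have [measurable]:
      "{\<rho> \<in> space M. cmp_real R (real_part (ev e1 \<rho>)) (real_part (ev e2 \<rho>))} \<in> sets M"
      by (rule measurable_cmp_real) measurable
    have 1: "test_sem ev (Cmp R e1 e2) \<rho> = {1} \<longleftrightarrow> ev e1 \<rho> \<noteq> Err \<and> ev e2 \<rho> \<noteq> Err \<and>
        cmp_real R (real_part (ev e1 \<rho>)) (real_part (ev e2 \<rho>))"
      and 0: "test_sem ev (Cmp R e1 e2) \<rho> = {0} \<longleftrightarrow> ev e1 \<rho> \<noteq> Err \<and> ev e2 \<rho> \<noteq> Err \<and>
        \<not> cmp_real R (real_part (ev e1 \<rho>)) (real_part (ev e2 \<rho>))" for \<rho>
      by (auto split: real_err.split)
    show ?case unfolding 0 1 by measurable
  next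
    case (Neg t)
    have "(-) 1 ` T = {1} \<longleftrightarrow> T = {0}" "(-) 1 ` T = {0} \<longleftrightarrow> T = {1}"
      if "T \<in> {{0}, {1}, {0, 1::nat}}" for T
      using that by (simp_all only: insert_iff empty_iff) (elim disjE; simp)+
    then show ?case
      using Neg by (simp only: test_sem_Neg test_sem_cases conj_commute)
  qed
  \<comment> \<open>For any other \<open>v\<close> the event is empty.\<close>
  moreover have "test_sem ev t \<rho> \<noteq> {v}" if "v \<noteq> 0" "v \<noteq> 1" for \<rho>
    using test_sem_cases[of ev t \<rho>] that by (simp only: insert_iff empty_iff) (elim disjE; simp)
  ultimately show ?thesis
    by (cases "v = 0"; cases "v = 1"; simp)
qed

section \<open>Expression evaluation and environment updates\<close>

lemma measurable_eval_real:
  "eval_real e \<in> borel_of (product_topology (\<lambda>_. real_err_topology) UNIV) \<rightarrow>\<^sub>M borel_of real_err_topology"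
proof (induction e)
  case (Var x)
  show ?case
    using measurable_product_projection[of x "\<lambda>_. real_err_topology"] by simp
qed (simp_all add: measurable_Num measurable_neg_err measurable_aop_err)

text \<open>Floating-point values enter real arithmetic and comparisons through this inclusion;
  continuity is automatic on a discrete space.\<close>

lemma continuous_map_floats_err:
  "continuous_map (discrete_topology (floats_err F)) real_err_topology id"
  by (simp add: continuous_map_from_discrete_topology)

text \<open>The codomain is the floating-point space, because assignment must stay among
  floating-point environments. Variables are projections, and every other expression ends with
  \<open>proj\<close>, which maps measurably into that space.\<close>

lemma measurable_eval_float:
  assumes "is_proj F proj"
  shows "eval_float proj e \<in> borel_of (product_topology (\<lambda>_. discrete_topology (floats_err F)) UNIV)
    \<rightarrow>\<^sub>M borel_of (discrete_topology (floats_err F))"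
proof -
  have proj: "proj \<in> borel_of real_err_topology \<rightarrow>\<^sub>M borel_of (discrete_topology (floats_err F))"
    using assms by (simp add: is_proj_def)
  \<comment> \<open>Induction hypotheses are weakened along the inclusion, so that real arithmetic
    can be applied before \<open>proj\<close>.\<close>
  have incl: "f \<in> M \<rightarrow>\<^sub>M borel_of real_err_topology"
    if "f \<in> M \<rightarrow>\<^sub>M borel_of (discrete_topology (floats_err F))" for f and M :: "('a \<Rightarrow> real_err) measure"
    using measurable_comp[OF that continuous_map_measurable_borel_of[OF continuous_map_floats_err]]
    by simp
  show ?thesis
  proof (induction e)
    case (Var x)
    show ?case
      using measurable_product_projection[of x "\<lambda>_. discrete_topology (floats_err F)"] by simp
  qed (simp_all add: incl measurable_Num measurable_neg_err measurable_aop_err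
        measurable_compose[OF _ proj])
qed

lemma measurable_eval:
  fixes e :: "'v expr"
  assumes "is_proj F proj"
  shows "eval s proj e \<in> borel_of (env_topology s F) \<rightarrow>\<^sub>M borel_of real_err_topology"
proof (cases s)
  case Real_Sem
  then show ?thesis by (simp add: measurable_eval_real)
next
  case Float_Sem
  then show ?thesis
    using measurable_comp[OF measurable_eval_float[OF assms]
        continuous_map_measurable_borel_of[OF continuous_map_floats_err], of e]
    by simp
qed

text \<open>Coordinate \<open>x\<close> of the new environment is the evaluated expression, the
  others are projections. Second countability of the value space, which in floating point comes from
  finiteness of \<open>F\<close>, makes the coordinates suffice.\<close>

lemma measurable_env_update:
  fixes e :: "'v::countable expr"
  assumes "finite F" "is_proj F proj"
  shows "(\<lambda>\<rho>. \<rho>(x := eval s proj e \<rho>)) \<in> borel_of (env_topology s F) \<rightarrow>\<^sub>M borel_of (env_topology s F)"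
proof -
  have *: "(\<lambda>\<rho>. (\<rho>(x := f \<rho>)) y) \<in> borel_of (product_topology (\<lambda>_. T) UNIV) \<rightarrow>\<^sub>M borel_of T"
    if "f \<in> borel_of (product_topology (\<lambda>_. T) UNIV) \<rightarrow>\<^sub>M borel_of T"
    for f and y :: 'v and T :: "real_err topology"
    using that measurable_product_projection[of y "\<lambda>_. T"] by (cases "y = x") simp_all
  show ?thesis
  proof (cases s)
    case Real_Sem
    then show ?thesis
      by (simp only: env_topology.simps eval.simps)
        (intro measurable_borel_of_product second_countable_real_err * measurable_eval_real)
  next
    case Float_Sem
    have "second_countable (discrete_topology (floats_err F))"
      using assms(1) by (simp add: second_countable_discrete_topology floats_err_def countable_finite)
    then show ?thesis
      unfolding Float_Sem env_topology.simps eval.simps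
      by (intro measurable_borel_of_product * measurable_eval_float assms)
  qed
qed

section \<open>Closure properties of previsions\<close>

text \<open>The properties are bundled because they interact under composition: subadditivity and
  \<omega>-continuity of a composite both use monotonicity.\<close>

definition upper_omega_prevision :: "'a topology \<Rightarrow> (('a \<Rightarrow> ennreal) \<Rightarrow> 'a \<Rightarrow> ennreal) \<Rightarrow> bool" where
  "upper_omega_prevision X G \<longleftrightarrow>
     parametric_prevision X G \<and> upper_prevision X G \<and> omega_continuous X G"

context
  fixes X :: "'a topology" and G :: "('a \<Rightarrow> ennreal) \<Rightarrow> 'a \<Rightarrow> ennreal"
  assumes G: "upper_omega_prevision X G"
begin

lemma prevision_Mplus: "f \<in> Mplus X \<Longrightarrow> G f \<in> Mplus X"
  using G by (simp add: upper_omega_prevision_def parametric_prevision_def)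

lemma prevision_scale:
  "f \<in> Mplus X \<Longrightarrow> 0 \<le> a \<Longrightarrow> x \<in> topspace X \<Longrightarrow>
    G (\<lambda>y. ennreal a * f y) x = ennreal a * G f x"
  using G by (simp add: upper_omega_prevision_def parametric_prevision_def)

lemma prevision_mono:
  "f \<in> Mplus X \<Longrightarrow> g \<in> Mplus X \<Longrightarrow> (\<And>x. x \<in> topspace X \<Longrightarrow> f x \<le> g x) \<Longrightarrow>
    x \<in> topspace X \<Longrightarrow> G f x \<le> G g x"
  using G by (simp add: upper_omega_prevision_def parametric_prevision_def)

text \<open>Functions in \<open>Mplus X\<close> may differ outside the space; monotonicity in both
  directions lets equations valid on \<open>topspace X\<close> be used under
  \<open>G\<close>.\<close>

lemma prevision_cong:
  "f \<in> Mplus X \<Longrightarrow> g \<in> Mplus X \<Longrightarrow> (\<And>x. x \<in> topspace X \<Longrightarrow> f x = g x) \<Longrightarrow>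
    x \<in> topspace X \<Longrightarrow> G f x = G g x"
  by (simp add: antisym prevision_mono)

lemma prevision_add:
  "f \<in> Mplus X \<Longrightarrow> g \<in> Mplus X \<Longrightarrow> x \<in> topspace X \<Longrightarrow>
    G (\<lambda>y. f y + g y) x \<le> G f x + G g x"
  using G by (simp add: upper_omega_prevision_def upper_prevision_def)

lemma prevision_SUP:
  "(\<And>n. f n \<in> Mplus X) \<Longrightarrow> (\<And>n x. x \<in> topspace X \<Longrightarrow> f n x \<le> f (Suc n) x) \<Longrightarrow>
    x \<in> topspace X \<Longrightarrow> G (\<lambda>y. SUP n. f n y) x = (SUP n. G (f n) x)"
  using G by (simp add: upper_omega_prevision_def omega_continuous_def)

end

lemma upper_omega_previsionI:
  fixes G :: "('a \<Rightarrow> ennreal) \<Rightarrow> 'a \<Rightarrow> ennreal"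
  assumes "\<And>f. f \<in> Mplus X \<Longrightarrow> G f \<in> Mplus X"
    and "\<And>f a x. f \<in> Mplus X \<Longrightarrow> 0 \<le> a \<Longrightarrow> x \<in> topspace X \<Longrightarrow>
      G (\<lambda>y. ennreal a * f y) x = ennreal a * G f x"
    and "\<And>f g x. f \<in> Mplus X \<Longrightarrow> g \<in> Mplus X \<Longrightarrow> (\<And>x. x \<in> topspace X \<Longrightarrow> f x \<le> g x) \<Longrightarrow>
      x \<in> topspace X \<Longrightarrow> G f x \<le> G g x"
    and "\<And>f g x. f \<in> Mplus X \<Longrightarrow> g \<in> Mplus X \<Longrightarrow> x \<in> topspace X \<Longrightarrow>
      G (\<lambda>y. f y + g y) x \<le> G f x + G g x"
    and "\<And>f x. (\<And>n. f n \<in> Mplus X) \<Longrightarrow> (\<And>n x. x \<in> topspace X \<Longrightarrow> f n x \<le> f (Suc n) x) \<Longrightarrow>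
      x \<in> topspace X \<Longrightarrow> G (\<lambda>y. SUP n::nat. f n y) x = (SUP n. G (f n) x)"
  shows "upper_omega_prevision X G"
  unfolding upper_omega_prevision_def parametric_prevision_def upper_prevision_def
    omega_continuous_def
  using assms by simp

lemma Mplus_scale: "f \<in> Mplus X \<Longrightarrow> (\<lambda>y. c * f y) \<in> Mplus X"
  by (simp add: Mplus_def)

lemma Mplus_add: "f \<in> Mplus X \<Longrightarrow> g \<in> Mplus X \<Longrightarrow> (\<lambda>y. f y + g y) \<in> Mplus X"
  by (simp add: Mplus_def)

lemma Mplus_SUP: "(\<And>n::nat. f n \<in> Mplus X) \<Longrightarrow> (\<lambda>y. SUP n. f n y) \<in> Mplus X"
  unfolding Mplus_def by measurable

section \<open>Operations that preserve upper \<omega>-continuous previsions\<close>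

lemma upper_omega_prevision_ident: "upper_omega_prevision X (\<lambda>f. f)"
  by (rule upper_omega_previsionI) auto

lemma upper_omega_prevision_bot: "upper_omega_prevision X bot"
  by (rule upper_omega_previsionI) (auto simp: Mplus_def bot_fun_def bot_ennreal)

lemma upper_omega_prevision_reindex:
  assumes u: "u \<in> borel_of X \<rightarrow>\<^sub>M borel_of X"
  shows "upper_omega_prevision X (\<lambda>f x. f (u x))"
proof -
  have "u x \<in> topspace X" if "x \<in> topspace X" for x
    using measurable_space[OF u, of x] that by simp
  then show ?thesis
    by (intro upper_omega_previsionI) (auto simp: Mplus_def intro: measurable_compose[OF u])
qed

lemma upper_omega_prevision_comp:
  assumes G: "upper_omega_prevision X G" and H: "upper_omega_prevision X H"
  shows "upper_omega_prevision X (\<lambda>f. G (H f))"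
proof (rule upper_omega_previsionI)
  fix f assume "f \<in> Mplus X"
  then show "G (H f) \<in> Mplus X"
    by (intro prevision_Mplus[OF G] prevision_Mplus[OF H])
next
  fix f a x assume f: "f \<in> Mplus X" and a: "0 \<le> (a::real)" and x: "x \<in> topspace X"
  have "G (H (\<lambda>y. ennreal a * f y)) x = G (\<lambda>y. ennreal a * H f y) x"
    by (intro prevision_cong[OF G] prevision_Mplus[OF H] Mplus_scale prevision_scale[OF H] f a x)
  also have "\<dots> = ennreal a * G (H f) x"
    by (intro prevision_scale[OF G] prevision_Mplus[OF H] f a x)
  finally show "G (H (\<lambda>y. ennreal a * f y)) x = ennreal a * G (H f) x" .
next
  fix f g x assume "f \<in> Mplus X" "g \<in> Mplus X" "\<And>x. x \<in> topspace X \<Longrightarrow> f x \<le> g x" "x \<in> topspace X"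
  then show "G (H f) x \<le> G (H g) x"
    by (intro prevision_mono[OF G] prevision_mono[OF H] prevision_Mplus[OF H])
next
  fix f g x assume f: "f \<in> Mplus X" and g: "g \<in> Mplus X" and x: "x \<in> topspace X"
  \<comment> \<open>Subadditivity of \<open>H\<close>, valid at each point of the space, passes
    through \<open>G\<close> by monotonicity.\<close>
  have "G (H (\<lambda>y. f y + g y)) x \<le> G (\<lambda>y. H f y + H g y) x"
    by (intro prevision_mono[OF G] prevision_Mplus[OF H] Mplus_add prevision_add[OF H] f g x)
  also have "\<dots> \<le> G (H f) x + G (H g) x"
    by (intro prevision_add[OF G] prevision_Mplus[OF H] f g x)
  finally show "G (H (\<lambda>y. f y + g y)) x \<le> G (H f) x + G (H g) x" .
next
  fix f x assume f: "\<And>n::nat. f n \<in> Mplus X" and inc: "\<And>n x. x \<in> topspace X \<Longrightarrow> f n x \<le> f (Suc n) x"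
    and x: "x \<in> topspace X"
  have "G (H (\<lambda>y. SUP n. f n y)) x = G (\<lambda>y. SUP n. H (f n) y) x"
    by (intro prevision_cong[OF G] prevision_Mplus[OF H] Mplus_SUP prevision_SUP[OF H] f inc x)
  \<comment> \<open>Monotonicity of \<open>H\<close> makes the functions \<open>H (f n)\<close>
    ascend, as \<omega>-continuity of \<open>G\<close> requires.\<close>
  also have "\<dots> = (SUP n. G (H (f n)) x)"
    by (intro prevision_SUP[OF G] prevision_Mplus[OF H] prevision_mono[OF H] f inc x)
  finally show "G (H (\<lambda>y. SUP n. f n y)) x = (SUP n. G (H (f n)) x)" .
qed

text \<open>Scaling and limits along \<open>f\<close> commute with the supremum over
  \<open>k\<close>. For sums only an inequality survives, since a supremum of sums can lie strictly
  below the sum of the suprema. Countability of the family keeps the result measurable.\<close>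

lemma upper_omega_prevision_SUP:
  fixes G :: "nat \<Rightarrow> ('a \<Rightarrow> ennreal) \<Rightarrow> 'a \<Rightarrow> ennreal"
  assumes G: "\<And>k. upper_omega_prevision X (G k)"
  shows "upper_omega_prevision X (\<lambda>f x. SUP k. G k f x)"
proof (rule upper_omega_previsionI)
  fix f assume "f \<in> Mplus X"
  then show "(\<lambda>x. SUP k. G k f x) \<in> Mplus X"
    by (intro Mplus_SUP prevision_Mplus[OF G])
next
  fix f a x assume "f \<in> Mplus X" "0 \<le> (a::real)" "x \<in> topspace X"
  then show "(SUP k. G k (\<lambda>y. ennreal a * f y) x) = ennreal a * (SUP k. G k f x)"
    by (simp add: prevision_scale[OF G] SUP_mult_left_ennreal)
next
  fix f g x assume "f \<in> Mplus X" "g \<in> Mplus X" "\<And>x. x \<in> topspace X \<Longrightarrow> f x \<le> g x" "x \<in> topspace X"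
  then show "(SUP k. G k f x) \<le> (SUP k. G k g x)"
    by (intro SUP_mono' prevision_mono[OF G])
next
  fix f g x assume "f \<in> Mplus X" "g \<in> Mplus X" "x \<in> topspace X"
  then show "(SUP k. G k (\<lambda>y. f y + g y) x) \<le> (SUP k. G k f x) + (SUP k. G k g x)"
    by (intro SUP_least order_trans[OF prevision_add[OF G]] add_mono SUP_upper) auto
next
  fix f x assume "\<And>n::nat. f n \<in> Mplus X" "\<And>n x. x \<in> topspace X \<Longrightarrow> f n x \<le> f (Suc n) x" "x \<in> topspace X"
  then have "(SUP k. G k (\<lambda>y. SUP n. f n y) x) = (SUP k. SUP n. G k (f n) x)"
    by (simp add: prevision_SUP[OF G])
  also have "\<dots> = (SUP n. SUP k. G k (f n) x)"
    by (rule SUP_commute)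
  finally show "(SUP k. G k (\<lambda>y. SUP n. f n y) x) = (SUP n. SUP k. G k (f n) x)" .
qed

lemma upper_omega_prevision_sup:
  assumes "upper_omega_prevision X G" "upper_omega_prevision X H"
  shows "upper_omega_prevision X (\<lambda>f x. sup (G f x) (H f x))"
proof -
  \<comment> \<open>The pair is presented as a sequence, with \<open>G\<close> at index 0 and
    \<open>H\<close> at every positive index.\<close>
  have "upper_omega_prevision X (\<lambda>f x. SUP k::nat. (if k = 0 then G else H) f x)"
    using assms by (intro upper_omega_prevision_SUP) auto
  moreover have "(SUP k::nat. (if k = 0 then G else H) f x) = sup (G f x) (H f x)" for f x
  proof -
    have "range (\<lambda>k::nat. (if k = 0 then G else H) f x) = {G f x, H f x}"
      by (auto simp: image_iff intro: exI[of _ "1::nat"])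
    then show ?thesis by simp
  qed
  ultimately show ?thesis by simp
qed

text \<open>Every condition except measurability concerns one point \<open>x\<close> at a time,
  where a single branch is selected.\<close>

lemma upper_omega_prevision_if:
  assumes G: "upper_omega_prevision X G" and H: "upper_omega_prevision X H"
    and A: "{x \<in> topspace X. Q x} \<in> sets (borel_of X)"
  shows "upper_omega_prevision X (\<lambda>f x. if Q x then G f x else H f x)"
proof (rule upper_omega_previsionI)
  fix f assume "f \<in> Mplus X"
  then have "G f \<in> Mplus X" "H f \<in> Mplus X"
    by (auto intro: prevision_Mplus[OF G] prevision_Mplus[OF H])
  then show "(\<lambda>x. if Q x then G f x else H f x) \<in> Mplus X"
    unfolding Mplus_def using A by (intro measurable_If) auto
qed (auto simp: prevision_scale[OF G] prevision_scale[OF H] prevision_SUP[OF G] prevision_SUP[OF H]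
    intro: prevision_mono[OF G] prevision_mono[OF H] prevision_add[OF G] prevision_add[OF H])

text \<open>A conditional and one unfolding of a loop share this shape, with the supremum of the
  branches for an undecided test.\<close>

lemma upper_omega_prevision_branch:
  assumes "upper_omega_prevision X G" "upper_omega_prevision X H"
    and "\<And>v. {x \<in> topspace X. T x = {v}} \<in> sets (borel_of X)"
  shows "upper_omega_prevision X
    (\<lambda>f x. if T x = {1::nat} then G f x else if T x = {0} then H f x else sup (G f x) (H f x))"
  by (intro upper_omega_prevision_if upper_omega_prevision_sup assms)

section \<open>Loops and weakest preconditions\<close>

lemma upper_omega_prevision_while:
  assumes W: "upper_omega_prevision X W"
    and T: "\<And>v. {x \<in> topspace X. T x = {v}} \<in> sets (borel_of X)"
  shows "upper_omega_prevision X (SUP n. (while_step T W ^^ n) bot)"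
proof -
  have step: "upper_omega_prevision X (while_step T W \<phi>)" if "upper_omega_prevision X \<phi>" for \<phi>
  proof -
    \<comment> \<open>Leaving the loop returns the continuation unchanged, so the second branch is
      the identity transformer.\<close>
    have "while_step T W \<phi> = (\<lambda>f x. if T x = {1} then W (\<phi> f) x
        else if T x = {0} then f x else sup (W (\<phi> f) x) (f x))"
      by (simp add: while_step_def fun_eq_iff)
    then show ?thesis
      by (simp only:) (rule upper_omega_prevision_branch[OF
          upper_omega_prevision_comp[OF W that] upper_omega_prevision_ident T])
  qed
  \<comment> \<open>The finite unfoldings start from \<open>bot\<close>, the zero transformer; the
    loop is their countable supremum.\<close>
  have "upper_omega_prevision X ((while_step T W ^^ n) bot)" for n
    by (induction n) (simp_all only: funpow.simps o_apply id_apply step upper_omega_prevision_bot)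
  then have "upper_omega_prevision X (\<lambda>f x. SUP n. (while_step T W ^^ n) bot f x)"
    by (rule upper_omega_prevision_SUP)
  moreover have "(SUP n. (while_step T W ^^ n) bot) = (\<lambda>f x. SUP n. (while_step T W ^^ n) bot f x)"
    by (simp add: fun_eq_iff image_comp)
  ultimately show ?thesis by simp
qed

text \<open>Abstracting from \<open>ev\<close> and \<open>X\<close> isolates what the induction asks
  of a semantics, namely measurable updates and test events, so both semantics become
  instances.\<close>

lemma upper_omega_prevision_wp:
  assumes upd: "\<And>x e. (\<lambda>\<rho>. \<rho>(x := ev e \<rho>)) \<in> borel_of X \<rightarrow>\<^sub>M borel_of X"
    and test: "\<And>t v. {\<rho> \<in> topspace X. test_sem ev t \<rho> = {v}} \<in> sets (borel_of X)"
  shows "upper_omega_prevision X (wp ev P)"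
proof (induction P)
  case (Cond t P1 P0)
  \<comment> \<open>The supremum over outcomes is a single branch for a singleton and a binary
    supremum for \<open>{0, 1}\<close>.\<close>
  have "wp ev (Cond t P1 P0) = (\<lambda>\<kappa> :: _ \<Rightarrow> ennreal. \<lambda>\<rho>. if test_sem ev t \<rho> = {1} then wp ev P1 \<kappa> \<rho>
      else if test_sem ev t \<rho> = {0} then wp ev P0 \<kappa> \<rho> else sup (wp ev P1 \<kappa> \<rho>) (wp ev P0 \<kappa> \<rho>))"
  proof (intro ext)
    fix \<kappa> :: "_ \<Rightarrow> ennreal" and \<rho>
    show "wp ev (Cond t P1 P0) \<kappa> \<rho> = (if test_sem ev t \<rho> = {1} then wp ev P1 \<kappa> \<rho>
      else if test_sem ev t \<rho> = {0} then wp ev P0 \<kappa> \<rho> else sup (wp ev P1 \<kappa> \<rho>) (wp ev P0 \<kappa> \<rho>))"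
      using test_sem_cases[of ev t \<rho>] by (simp only: insert_iff empty_iff) (elim disjE; simp add: sup_commute)
  qed
  then show ?case
    by (simp only:) (rule upper_omega_prevision_branch[OF Cond test])
next
  case (While t P)
  then show ?case
    by (simp only: wp.simps) (intro upper_omega_prevision_while test)
next
  case (Seq P Q)
  then show ?case by (simp add: upper_omega_prevision_comp)
qed (simp_all add: upper_omega_prevision_ident upper_omega_prevision_reindex upd)

theorem proposition5:
  fixes F :: "real set"
    and proj :: "real_err \<Rightarrow> real_err"
    and s :: semantics
    and P :: "'v::countable instr"
  assumes "finite F" and "F \<noteq> {}"
    and "is_proj F proj"
  shows "parametric_prevision (env_topology s F) (wp (eval s proj) P)
    \<and> upper_prevision (env_topology s F) (wp (eval s proj) P)
    \<and> omega_continuous (env_topology s F) (wp (eval s proj) P)"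
proof -
  have "{\<rho> \<in> topspace (env_topology s F). test_sem (eval s proj) t \<rho> = {v}}
      \<in> sets (borel_of (env_topology s F))" for t :: "'v test" and v
    using measurable_test_sem[OF measurable_eval[OF assms(3)]] by simp
  then have "upper_omega_prevision (env_topology s F) (wp (eval s proj) P)"
    by (intro upper_omega_prevision_wp measurable_env_update assms)
  then show ?thesis by (simp add: upper_omega_prevision_def)
qed

end
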